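(* Let $H$ be an infinite-dimensional separable complex Hilbert space, let $A\in C([0,1], L(H))$ and let $d \in C([0,1])$ be such that $d(t)\in \operatorname{Int} W_e(A(t))$ for all $t\in[0,1]$; let $\theta=\min\{\operatorname{dist} (d(t),\partial W_e(A(t))): 0\le t\le 1\}$, let $\varepsilon\in (0,\theta)$, and let $v \in C([0,1], S_H)$ satisfy $|\langle A(t)v(t),v(t)\rangle-d(t)|\le \varepsilon$ for all $t\in[0,1]$. If $M\subset H$ is a closed infinite-dimensional subspace such that $W_e(P_MA(t){\upharpoonright}_M)=W_e(A(t))$ for all $t \in [0,1]$, then there exists $u \in C([0,1], H)$ such that for all $t \in [0,1]$: (i) $\langle A(t)u(t),u(t)\rangle=d(t)$ and $\|u(t)\|=1$; (ii) $\|u(t)-v(t)\|\le 12\sqrt{\varepsilon/\theta}$; (iii) $u(t)\in \operatorname{span}\{v(t)\}\vee M$.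
   Context: $S_H=\{x\in H:\|x\|=1\}$ is the unit sphere. $\vee$ denotes the closed linear span of the union of subspaces. $P_M$ is the orthogonal projection onto $M$. For $T\in L(K)$ the essential numerical range $W_e(T)$ is the set of all $\lambda\in\mathbb C$ for which there is an orthonormal sequence $(u_n)$ in $K$ with $\langle Tu_n,u_n\rangle\to\lambda$; $\operatorname{Int}$, $\partial$ are interior and boundary in $\mathbb C$. *)

theory Defs
  imports "HOL-Analysis.Analysis"
begin

class chilbert_space = banach +
  fixes scaleC :: "complex \<Rightarrow> 'a \<Rightarrow> 'a"
    and cinner :: "'a \<Rightarrow> 'a \<Rightarrow> complex"
  assumes scaleC_add_right: "scaleC a (x + y) = scaleC a x + scaleC a y"
    and scaleC_add_left: "scaleC (a + b) x = scaleC a x + scaleC b x"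
    and scaleC_scaleC: "scaleC a (scaleC b x) = scaleC (a * b) x"
    and scaleC_one: "scaleC 1 x = x"
    and scaleR_scaleC: "scaleR r x = scaleC (complex_of_real r) x"
    and cinner_add_left: "cinner (x + y) z = cinner x z + cinner y z"
    and cinner_scaleC_left: "cinner (scaleC a x) y = a * cinner x y"
    and cinner_commute: "cinner x y = cnj (cinner y x)"
    and cinner_self_norm: "cinner x x = complex_of_real ((norm x)\<^sup>2)"

definition clinear_map :: "('a::chilbert_space \<Rightarrow> 'a) \<Rightarrow> bool" where
  "clinear_map f \<longleftrightarrow> (\<forall>a x. f (scaleC a x) = scaleC a (f x))"

definition cspan :: "'a::chilbert_space set \<Rightarrow> 'a set" where
  "cspan S = {x. \<exists>F c. finite F \<and> F \<subseteq> S \<and> x = (\<Sum>v\<in>F. scaleC (c v) v)}"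

definition csubspace :: "'a::chilbert_space set \<Rightarrow> bool" where
  "csubspace M \<longleftrightarrow> 0 \<in> M \<and> (\<forall>x\<in>M. \<forall>y\<in>M. x + y \<in> M) \<and> (\<forall>a. \<forall>x\<in>M. scaleC a x \<in> M)"

definition cfinite_dim :: "'a::chilbert_space set \<Rightarrow> bool" where
  "cfinite_dim S \<longleftrightarrow> (\<exists>F. finite F \<and> S \<subseteq> cspan F)"

definition csep_space :: "'a::chilbert_space itself \<Rightarrow> bool" where
  "csep_space _ \<longleftrightarrow> (\<exists>C::'a set. countable C \<and> closure C = UNIV)"

definition cproj :: "'a::chilbert_space set \<Rightarrow> 'a \<Rightarrow> 'a" where
  "cproj M x = (THE y. y \<in> M \<and> (\<forall>z\<in>M. cinner (x - y) z = 0))"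

definition corthonormal_seq :: "(nat \<Rightarrow> 'a::chilbert_space) \<Rightarrow> bool" where
  "corthonormal_seq u \<longleftrightarrow> (\<forall>n m. cinner (u n) (u m) = (if n = m then 1 else 0))"

text \<open>Essential numerical range of an operator T on the subspace K
  (T regarded as an operator in L(K)).\<close>
definition ess_numrange_on :: "'a::chilbert_space set \<Rightarrow> ('a \<Rightarrow> 'a) \<Rightarrow> complex set" where
  "ess_numrange_on K T = {l. \<exists>u. (\<forall>n. u n \<in> K) \<and> corthonormal_seq u \<and>
      (\<lambda>n. cinner (T (u n)) (u n)) \<longlonglongrightarrow> l}"

abbreviation ess_numrange :: "('a::chilbert_space \<Rightarrow> 'a) \<Rightarrow> complex set" where
  "ess_numrange T \<equiv> ess_numrange_on UNIV T"

end

theory Submission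
  imports Defs
begin

text \<open>
  Write \<open>\<langle>A v, v\<rangle> = d + e\<close> with \<open>|e| \<le> \<epsilon>\<close> and put \<open>K = \<theta> / (2 \<epsilon>)\<close>. The point \<open>d - K e\<close> still lies in the
  disc of radius \<open>\<theta>\<close> about \<open>d\<close>, hence in the essential numerical range of the compression to \<open>M\<close>.
  If \<open>w\<close> is a path of unit vectors in \<open>M\<close> with \<open>\<langle>A w, w\<rangle> = d - K e\<close>, orthogonal to \<open>v\<close>, with \<open>A v\<close> and
  \<open>A\<^sup>* v\<close> orthogonal to \<open>w\<close>, and if \<open>a\<^sup>2 + b\<^sup>2 = 1\<close> and \<open>a\<^sup>2 = K b\<^sup>2\<close>, then \<open>u = a v + b w\<close> satisfies
  \<open>\<langle>A u, u\<rangle> = d\<close>, and \<open>u - v\<close> has norm at most \<open>3 \<surd>(\<epsilon> / \<theta>)\<close> because \<open>b\<^sup>2 \<le> 2 \<epsilon> / \<theta>\<close>. All relations for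
  \<open>w\<close> can be met up to an arbitrarily small error: orthonormal sequences converge weakly to zero, so
  vectors \<open>w\<^sub>i\<close> for a fine mesh of \<open>[0,1]\<close> can be picked one after the other, each nearly orthogonal to
  its predecessor, and they are joined by \<open>\<surd>(1 - s) w\<^sub>i + \<surd>s w\<^sub>i\<^sub>+\<^sub>1\<close>. Hence \<open>\<epsilon>\<close> can be lowered to \<open>\<epsilon> / 4\<close> by
  a move of size \<open>4 \<surd>(\<epsilon> / \<theta>)\<close>, and iterating this gives a uniformly convergent sequence whose limit is
  within \<open>8 \<surd>(\<epsilon> / \<theta>)\<close> of \<open>v\<close>.
\<close>

section \<open>Algebra of the complex inner product\<close>

lemma cinner_zero_left [simp]: "cinner (0::'a::chilbert_space) y = 0"
  using cinner_add_left[of "0::'a" 0 y] by simp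

lemma cinner_add_right: "cinner x (y + z) = cinner x y + cinner x (z::'a::chilbert_space)"
  by (metis cinner_commute cinner_add_left complex_cnj_add)

lemma cinner_scaleC_right: "cinner x (scaleC a y) = cnj a * cinner x (y::'a::chilbert_space)"
  by (metis cinner_commute cinner_scaleC_left complex_cnj_mult)

lemma cmod_cinner_commute: "cmod (cinner x y) = cmod (cinner y (x::'a::chilbert_space))"
  by (metis cinner_commute complex_mod_cnj)

text \<open>Cauchy-Schwarz, the parallelogram law, the variational argument for projections and
  Pythagoras for orthonormal sums are all read off from this expansion.\<close>

lemma norm_add_scaleC_sq:
  "(norm (x + scaleC c y))\<^sup>2 = (norm x)\<^sup>2 + (cmod c)\<^sup>2 * (norm y)\<^sup>2 + 2 * Re (cnj c * cinner x (y::'a::chilbert_space))"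
proof -
  have "complex_of_real ((norm (x + scaleC c y))\<^sup>2) = cinner (x + scaleC c y) (x + scaleC c y)"
    by (simp add: cinner_self_norm)
  also have "\<dots> = cinner x x + c * cnj c * cinner y y + (cnj c * cinner x y + cnj (cnj c * cinner x y))"
    by (simp add: cinner_add_left cinner_add_right cinner_scaleC_left cinner_scaleC_right
        cinner_commute[of y x] algebra_simps)
  also have "\<dots> = complex_of_real ((norm x)\<^sup>2 + (cmod c)\<^sup>2 * (norm y)\<^sup>2 + 2 * Re (cnj c * cinner x y))"
    unfolding cinner_self_norm complex_add_cnj complex_norm_square[symmetric] by simp
  finally show ?thesis
    using of_real_eq_iff by blast
qed

lemma cmod_cinner_le: "cmod (cinner x y) \<le> norm x * norm (y::'a::chilbert_space)"
proof (cases "y = 0")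
  case True
  then show ?thesis using cmod_cinner_commute[of x y] by simp
next
  case False
  define i where "i = cinner x y"
  \<comment> \<open>\<open>c\<close> minimises \<open>norm (x + scaleC c y)\<close>; for this value,
    nonnegativity of the squared norm is the Cauchy-Schwarz inequality.\<close>
  define c where "c = - i / of_real ((norm y)\<^sup>2)"
  have n: "norm y > 0" using False by simp
  have "cnj c * i = - ((i * cnj i) / of_real ((norm y)\<^sup>2))"
    by (simp add: c_def)
  also have "\<dots> = - of_real ((cmod i)\<^sup>2 / (norm y)\<^sup>2)"
    by (simp only: complex_norm_square[symmetric] of_real_divide)
  finally have r: "Re (cnj c * i) = - ((cmod i)\<^sup>2 / (norm y)\<^sup>2)" by simp
  have "cmod c = cmod i / (norm y)\<^sup>2" by (simp add: c_def norm_divide norm_power)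
  then have "(cmod c)\<^sup>2 * (norm y)\<^sup>2 = (cmod i)\<^sup>2 / (norm y)\<^sup>2"
    using n by (simp add: power2_eq_square)
  then have "0 \<le> (norm x)\<^sup>2 - (cmod i)\<^sup>2 / (norm y)\<^sup>2"
    using norm_add_scaleC_sq[of x c y] r zero_le_power2[of "norm (x + scaleC c y)"]
    unfolding i_def by linarith
  then have "(cmod i)\<^sup>2 \<le> (norm x * norm y)\<^sup>2"
    using n by (simp add: pos_divide_le_eq power_mult_distrib)
  then show ?thesis
    unfolding i_def by (rule power2_le_imp_le) simp
qed

interpretation cinner: bounded_bilinear "cinner :: 'a::chilbert_space \<Rightarrow> 'a \<Rightarrow> complex"
proof
  fix r :: real and x y :: 'a
  show "cinner (r *\<^sub>R x) y = r *\<^sub>R cinner x y"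
    by (simp add: scaleR_scaleC cinner_scaleC_left scaleR_conv_of_real)
  show "cinner x (r *\<^sub>R y) = r *\<^sub>R cinner x y"
    by (simp add: scaleR_scaleC cinner_scaleC_right scaleR_conv_of_real)
qed (auto simp: cinner_add_left cinner_add_right intro!: exI[of _ 1] cmod_cinner_le)

section \<open>Subspaces and orthogonal projection\<close>

lemma scaleC_minus_one: "scaleC (-1) x = - (x::'a::chilbert_space)"
  using scaleR_scaleC[of "-1" x] by simp

lemma csubspace_scaleR: "csubspace M \<Longrightarrow> x \<in> M \<Longrightarrow> r *\<^sub>R x \<in> M"
  by (simp add: csubspace_def scaleR_scaleC)

lemma csubspace_diff: "csubspace M \<Longrightarrow> x \<in> M \<Longrightarrow> y \<in> M \<Longrightarrow> x - y \<in> M"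
  using csubspace_scaleR[of M y "-1"] unfolding csubspace_def
  by (metis add_uminus_conv_diff scaleR_minus1_left)

lemma parallelogram_law:
  "(norm (x + y))\<^sup>2 + (norm (x - y))\<^sup>2 = 2 * (norm x)\<^sup>2 + 2 * (norm (y::'a::chilbert_space))\<^sup>2"
  using norm_add_scaleC_sq[of x 1 y] norm_add_scaleC_sq[of x "-1" y]
  by (simp add: scaleC_one scaleC_minus_one)

text \<open>Midpoints of a minimising sequence stay in \<open>M\<close>, so the parallelogram law
  bounds the mutual distances of its members by their excess over the infimum; the sequence is
  therefore Cauchy.\<close>

lemma closest_point_closed_csubspace:
  fixes x :: "'a::chilbert_space"
  assumes M: "csubspace M" and cl: "closed M"
  shows "\<exists>y\<in>M. \<forall>z\<in>M. norm (x - y) \<le> norm (x - z)"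
proof -
  have ne: "M \<noteq> {}" using M by (auto simp: csubspace_def)
  define D where "D = infdist x M"
  have D0: "0 \<le> D" by (simp add: D_def infdist_nonneg)
  have le: "D \<le> norm (x - z)" if "z \<in> M" for z
    using infdist_le[OF that, of x] by (simp add: D_def dist_norm)
  have "\<exists>z\<in>M. (norm (x - z))\<^sup>2 < D\<^sup>2 + inverse (real (Suc n))" for n
  proof -
    have "D < sqrt (D\<^sup>2 + inverse (real (Suc n)))"
      using D0 by (intro real_less_rsqrt) simp
    then have "\<exists>z\<in>M. dist x z < sqrt (D\<^sup>2 + inverse (real (Suc n)))"
      using cINF_less_iff[OF ne bdd_below_image_dist, of x] ne unfolding D_def infdist_notempty[OF ne] by blast
    then obtain z where "z \<in> M" "norm (x - z) < sqrt (D\<^sup>2 + inverse (real (Suc n)))"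
      by (auto simp: dist_norm)
    then have "(norm (x - z))\<^sup>2 < (sqrt (D\<^sup>2 + inverse (real (Suc n))))\<^sup>2"
      by (intro power_strict_mono) auto
    also have "\<dots> = D\<^sup>2 + inverse (real (Suc n))" by (simp add: add_nonneg_nonneg)
    finally show ?thesis using \<open>z \<in> M\<close> by blast
  qed
  then obtain y where y: "\<And>n. y n \<in> M" "\<And>n. (norm (x - y n))\<^sup>2 < D\<^sup>2 + inverse (real (Suc n))"
    by metis
  have close: "(norm (y m - y n))\<^sup>2 \<le> 2 * inverse (real (Suc m)) + 2 * inverse (real (Suc n))" for m n
  proof -
    have "(1/2) *\<^sub>R (y m + y n) \<in> M"
      using y(1) M by (auto intro!: csubspace_scaleR simp: csubspace_def)
    then have "D\<^sup>2 \<le> (norm (x - (1/2) *\<^sub>R (y m + y n)))\<^sup>2"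
      using le D0 by (intro power_mono) auto
    moreover have "norm ((x - y m) + (x - y n)) = 2 * norm (x - (1/2) *\<^sub>R (y m + y n))"
    proof -
      have "(x - y m) + (x - y n) = 2 *\<^sub>R (x - (1/2) *\<^sub>R (y m + y n))"
        by (simp add: algebra_simps scaleR_2)
      then show ?thesis by simp
    qed
    moreover have "norm ((x - y m) - (x - y n)) = norm (y m - y n)"
      by (simp add: norm_minus_commute)
    ultimately show ?thesis
      using parallelogram_law[of "x - y m" "x - y n"] y(2)[of m] y(2)[of n]
      by (simp add: power_mult_distrib)
  qed
  have "Cauchy y"
  proof (rule CauchyI)
    fix e :: real assume "0 < e"
    then obtain k where k: "inverse (real (Suc k)) < e\<^sup>2 / 4"
      using reals_Archimedean[of "e\<^sup>2 / 4"] by auto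
    have "norm (y m - y n) < e" if "m \<ge> k" "n \<ge> k" for m n
    proof -
      have "inverse (real (Suc m)) \<le> inverse (real (Suc k))" "inverse (real (Suc n)) \<le> inverse (real (Suc k))"
        using that by auto
      then have "(norm (y m - y n))\<^sup>2 < e\<^sup>2" using close[of m n] k by linarith
      then show ?thesis using \<open>0 < e\<close> power2_less_imp_less by fastforce
    qed
    then show "\<exists>k. \<forall>m\<ge>k. \<forall>n\<ge>k. norm (y m - y n) < e" by blast
  qed
  then obtain l where l: "y \<longlonglongrightarrow> l"
    using Cauchy_convergent_iff convergent_def by blast
  have "l \<in> M"
    using closed_sequentially[OF cl _ l] y(1) by blast
  moreover have "(norm (x - l))\<^sup>2 \<le> D\<^sup>2"
  proof (rule LIMSEQ_le)
    show "(\<lambda>n. (norm (x - y n))\<^sup>2) \<longlonglongrightarrow> (norm (x - l))\<^sup>2"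
      by (intro tendsto_intros l)
    show "(\<lambda>n. D\<^sup>2 + inverse (real (Suc n))) \<longlonglongrightarrow> D\<^sup>2"
      using tendsto_add[OF tendsto_const LIMSEQ_inverse_real_of_nat, of "D\<^sup>2"] by simp
  qed (use y(2) less_imp_le in blast)
  then have "norm (x - l) \<le> D" using D0 by (rule power2_le_imp_le)
  ultimately show ?thesis using le order_trans by blast
qed

text \<open>First variation at the closest point \<open>y\<close>: were
  \<open>cinner (x - y) z\<close> nonzero, a small move along \<open>z\<close> would bring
  \<open>y\<close> nearer to \<open>x\<close>.\<close>

lemma orthogonal_projection_exists:
  fixes x :: "'a::chilbert_space"
  assumes M: "csubspace M" and cl: "closed M"
  shows "\<exists>y\<in>M. \<forall>z\<in>M. cinner (x - y) z = 0"
proof -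
  obtain y where y: "y \<in> M" "\<And>z. z \<in> M \<Longrightarrow> norm (x - y) \<le> norm (x - z)"
    using closest_point_closed_csubspace[OF assms] by blast
  have "cinner (x - y) z = 0" if z: "z \<in> M" for z
  proof (rule ccontr)
    define i where "i = cinner (x - y) z"
    assume "cinner (x - y) z \<noteq> 0"
    then have i: "cmod i > 0" by (simp add: i_def)
    \<comment> \<open>\<open>r\<close> is so small that the linear gain \<open>2 * r * |i|^2\<close>
      beats the quadratic cost \<open>r^2 * |i|^2 * |z|^2\<close>; the summand 1 keeps the
      denominator positive.\<close>
    define r where "r = 1 / ((norm z)\<^sup>2 + 1)"
    have "0 \<le> (norm z)\<^sup>2" by simp
    then have "0 < (norm z)\<^sup>2 + 1" by linarith
    then have r: "r > 0" "r * (norm z)\<^sup>2 < 1" unfolding r_def by (simp_all add: divide_less_eq)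
    define c where "c = - of_real r * i"
    have "y - scaleC c z \<in> M"
      using M y(1) z by (intro csubspace_diff) (auto simp: csubspace_def)
    then have "norm (x - y) \<le> norm ((x - y) + scaleC c z)"
      using y(2)[of "y - scaleC c z"] by (simp add: algebra_simps)
    then have "(norm (x - y))\<^sup>2 \<le> (norm ((x - y) + scaleC c z))\<^sup>2" by (intro power_mono) auto
    moreover have "cnj c * i = - (of_real r * (i * cnj i))"
      by (simp add: c_def)
    then have "cnj c * i = - of_real (r * (cmod i)\<^sup>2)"
      by (simp only: complex_norm_square[symmetric] of_real_mult)
    then have "Re (cnj c * i) = - (r * (cmod i)\<^sup>2)" by simp
    moreover have "(cmod c)\<^sup>2 = r\<^sup>2 * (cmod i)\<^sup>2"
      by (simp add: c_def norm_mult power_mult_distrib)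
    ultimately have "2 * (r * (cmod i)\<^sup>2) \<le> r\<^sup>2 * (cmod i)\<^sup>2 * (norm z)\<^sup>2"
      using norm_add_scaleC_sq[of "x - y" c z] by (simp add: i_def[symmetric])
    also have "\<dots> = (r * (cmod i)\<^sup>2) * (r * (norm z)\<^sup>2)" by (simp add: power2_eq_square)
    also have "\<dots> \<le> (r * (cmod i)\<^sup>2) * 1" using r by (intro mult_left_mono) auto
    finally show False using r i by simp
  qed
  then show ?thesis using y(1) by blast
qed

text \<open>The description in \<open>cproj_def\<close> is unique because two candidates differ by
  an element of \<open>M\<close> that is orthogonal to itself.\<close>

lemma cproj:
  fixes x :: "'a::chilbert_space"
  assumes M: "csubspace M" and cl: "closed M"
  shows "cproj M x \<in> M \<and> (\<forall>z\<in>M. cinner (x - cproj M x) z = 0)"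
  unfolding cproj_def
proof (rule theI', rule ex_ex1I)
  show "\<exists>y. y \<in> M \<and> (\<forall>z\<in>M. cinner (x - y) z = 0)"
    using orthogonal_projection_exists[OF assms] by blast
next
  fix y y' assume a: "y \<in> M \<and> (\<forall>z\<in>M. cinner (x - y) z = 0)" "y' \<in> M \<and> (\<forall>z\<in>M. cinner (x - y') z = 0)"
  then have "y - y' \<in> M" using M csubspace_diff by blast
  then have "cinner (x - y') (y - y') - cinner (x - y) (y - y') = 0" using a by simp
  then have "cinner (y - y') (y - y') = 0" by (simp add: cinner.diff_left[symmetric])
  then show "y = y'" by (simp add: cinner_self_norm)
qed

lemma cinner_cproj:
  assumes "csubspace M" "closed M" "z \<in> M"
  shows "cinner (cproj M x) z = cinner x z"
  using cproj[OF assms(1,2), of x] assms(3) by (simp add: cinner.diff_left)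

section \<open>Orthonormal sequences and weak convergence to zero\<close>

lemma corthonormal_seq_norm: "corthonormal_seq x \<Longrightarrow> norm (x n) = 1"
proof -
  assume "corthonormal_seq x"
  then have "complex_of_real ((norm (x n))\<^sup>2) = 1"
    using cinner_self_norm[of "x n"] by (simp add: corthonormal_seq_def)
  then have "(norm (x n))\<^sup>2 = 1" using of_real_eq_1_iff by blast
  then show "norm (x n) = 1"
    using norm_ge_zero[of "x n"] by (auto simp: power2_eq_1_iff simp del: norm_ge_zero)
qed

lemma corthonormal_sum_norm_sq:
  assumes "corthonormal_seq x"
  shows "(norm (\<Sum>n<N. scaleC (c n) (x n)))\<^sup>2 = (\<Sum>n<N. (cmod (c n))\<^sup>2)"
proof (induction N)
  case (Suc N)
  have "cinner (\<Sum>n<N. scaleC (c n) (x n)) (x N) = 0"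
    using assms by (auto simp: cinner.sum_left cinner_scaleC_left corthonormal_seq_def)
  then show ?case
    using Suc norm_add_scaleC_sq[of "\<Sum>n<N. scaleC (c n) (x n)" "c N" "x N"]
      corthonormal_seq_norm[OF assms, of N] by simp
qed simp

text \<open>Bessel's inequality for the functional \<open>\<langle>T \<cdot>, y\<rangle>\<close>; stating it this way avoids adjoints.\<close>
lemma bessel_operator:
  fixes T :: "'a::chilbert_space \<Rightarrow>\<^sub>L 'a"
  assumes x: "corthonormal_seq x" and T: "clinear_map (blinfun_apply T)"
  shows "(\<Sum>n<N. (cmod (cinner (T (x n)) y))\<^sup>2) \<le> (norm T * norm y)\<^sup>2"
proof -
  define f where "f n = cinner (T (x n)) y" for n
  define S where "S = (\<Sum>n<N. (cmod (f n))\<^sup>2)"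
  \<comment> \<open>The conjugate coefficients turn \<open>cinner (T z) y\<close> into
    \<open>S\<close>, which is also the square of \<open>norm z\<close>; Cauchy-Schwarz then bounds
    \<open>norm z\<close> itself.\<close>
  define z where "z = (\<Sum>n<N. scaleC (cnj (f n)) (x n))"
  have S0: "0 \<le> S" by (simp add: S_def sum_nonneg)
  have z: "(norm z)\<^sup>2 = S"
    unfolding z_def S_def corthonormal_sum_norm_sq[OF x] by simp
  have "cinner (T z) y = (\<Sum>n<N. cnj (f n) * f n)"
    using T by (simp add: z_def blinfun.sum_right cinner.sum_left clinear_map_def cinner_scaleC_left f_def)
  also have "\<dots> = of_real S"
    unfolding S_def of_real_sum by (intro sum.cong refl) (simp only: complex_norm_square mult.commute[of "cnj _"])
  finally have "S = cmod (cinner (T z) y)" using S0 by simp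
  also have "\<dots> \<le> norm (T z) * norm y" by (rule cmod_cinner_le)
  also have "\<dots> \<le> (norm T * norm z) * norm y" by (intro mult_right_mono norm_blinfun) auto
  finally have *: "(norm z)\<^sup>2 \<le> (norm T * norm y) * norm z" by (simp add: z mult_ac)
  have "norm z \<le> norm T * norm y"
  proof (cases "norm z = 0")
    case False
    then show ?thesis using * by (simp add: power2_eq_square)
  qed simp
  then have "(norm z)\<^sup>2 \<le> (norm T * norm y)\<^sup>2" by (intro power_mono) auto
  then show ?thesis by (simp add: z S_def f_def)
qed

text \<open>Bessel bounds the partial sums of the squares, so their series converges and its terms
  vanish.\<close>

lemma corthonormal_operator_tendsto_0:
  fixes T :: "'a::chilbert_space \<Rightarrow>\<^sub>L 'a"
  assumes "corthonormal_seq x" "clinear_map (blinfun_apply T)"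
  shows "(\<lambda>n. cinner (T (x n)) y) \<longlonglongrightarrow> 0"
proof -
  have "summable (\<lambda>n. (cmod (cinner (T (x n)) y))\<^sup>2)"
    using bessel_operator[OF assms] by (intro summableI_nonneg_bounded) auto
  then have "(\<lambda>n. (cmod (cinner (T (x n)) y))\<^sup>2) \<longlonglongrightarrow> 0"
    by (rule summable_LIMSEQ_zero)
  then have "(\<lambda>n. sqrt ((cmod (cinner (T (x n)) y))\<^sup>2)) \<longlonglongrightarrow> sqrt 0"
    by (intro tendsto_real_sqrt)
  then show ?thesis by (simp add: tendsto_norm_zero_iff)
qed

lemma clinear_map_id_blinfun: "clinear_map (blinfun_apply id_blinfun)"
  by (simp add: clinear_map_def)

text \<open>Three instances of the previous limit: the identity against \<open>y\<close>,
  \<open>T\<close> against \<open>y\<close>, and the identity against \<open>T y\<close>.\<close>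

lemma corthonormal_eventually_small:
  fixes T :: "'a::chilbert_space \<Rightarrow>\<^sub>L 'a"
  assumes x: "corthonormal_seq x" and T: "clinear_map (blinfun_apply T)" and \<eta>: "0 < \<eta>"
  shows "\<forall>\<^sub>F n in sequentially. cmod (cinner (x n) y) \<le> \<eta> \<and> cmod (cinner (T (x n)) y) \<le> \<eta>
           \<and> cmod (cinner (T y) (x n)) \<le> \<eta>"
proof -
  have *: "\<forall>\<^sub>F n in sequentially. cmod (cinner (S (x n)) z) \<le> \<eta>"
    if "clinear_map (blinfun_apply S)" for S :: "'a \<Rightarrow>\<^sub>L 'a" and z
    using tendstoD[OF corthonormal_operator_tendsto_0[OF x that] \<eta>, of z]
    by (auto elim: eventually_mono)
  show ?thesis
    using *[OF clinear_map_id_blinfun, of y] *[OF T, of y] *[OF clinear_map_id_blinfun, of "T y"]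
    by eventually_elim (simp add: cmod_cinner_commute[of "T y"])
qed

section \<open>Perturbation estimates for quadratic forms\<close>

text \<open>The squared weights sum to 1, so the diagonal errors are averaged and cost \<delta>
  once, while the two cross terms cost \<kappa> each. With the identity for \<open>T\<close> the
  same bound controls the norm of the combination.\<close>

lemma cmod_quadratic_form_combination:
  fixes T :: "'a::chilbert_space \<Rightarrow>\<^sub>L 'a"
  assumes "a\<^sup>2 + b\<^sup>2 = 1"
    and "cmod (cinner (T x) x - \<alpha>) \<le> \<delta>" "cmod (cinner (T y) y - \<beta>) \<le> \<delta>"
    and "cmod (cinner (T x) y) \<le> \<kappa>" "cmod (cinner (T y) x) \<le> \<kappa>"
  shows "cmod (cinner (T (a *\<^sub>R x + b *\<^sub>R y)) (a *\<^sub>R x + b *\<^sub>R y) - (of_real (a\<^sup>2) * \<alpha> + of_real (b\<^sup>2) * \<beta>))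
           \<le> \<delta> + 2 * \<kappa>"
proof -
  have "0 \<le> (\<bar>a\<bar> - \<bar>b\<bar>)\<^sup>2" by simp
  then have ab: "\<bar>a * b\<bar> \<le> 1"
    using assms(1) by (simp add: power2_diff abs_mult)
  have eq: "cinner (T (a *\<^sub>R x + b *\<^sub>R y)) (a *\<^sub>R x + b *\<^sub>R y) - (of_real (a\<^sup>2) * \<alpha> + of_real (b\<^sup>2) * \<beta>)
     = a\<^sup>2 *\<^sub>R (cinner (T x) x - \<alpha>) + b\<^sup>2 *\<^sub>R (cinner (T y) y - \<beta>)
       + ((a * b) *\<^sub>R cinner (T x) y + (a * b) *\<^sub>R cinner (T y) x)"
    by (simp add: blinfun.add_right blinfun.scaleR_right cinner_add_left cinner_add_right
        cinner.scaleR_left cinner.scaleR_right scaleR_conv_of_real algebra_simps power2_eq_square)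
  have c: "norm ((a * b) *\<^sub>R z) \<le> \<kappa>" if "cmod z \<le> \<kappa>" for z :: complex
    using mult_mono[OF ab that] by (simp add: abs_mult)
  have "norm (a\<^sup>2 *\<^sub>R (cinner (T x) x - \<alpha>)) \<le> a\<^sup>2 * \<delta>" "norm (b\<^sup>2 *\<^sub>R (cinner (T y) y - \<beta>)) \<le> b\<^sup>2 * \<delta>"
    using assms(2,3) by (auto intro!: mult_left_mono)
  moreover have "a\<^sup>2 * \<delta> + b\<^sup>2 * \<delta> = \<delta>"
    using assms(1) by (simp add: distrib_right[symmetric])
  ultimately show ?thesis
    unfolding eq using norm_triangle_mono[OF norm_triangle_mono norm_triangle_mono[OF c[OF assms(4)] c[OF assms(5)]]]
    by fastforce
qed

lemma cmod_cinner_blinfun_le: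
  fixes T :: "'a::chilbert_space \<Rightarrow>\<^sub>L 'a"
  shows "cmod (cinner (T x) y) \<le> norm T * norm x * norm y"
  by (meson cmod_cinner_le mult_right_mono norm_blinfun norm_ge_zero order_trans)

text \<open>The operator, the left vector and the right vector are exchanged one at a time; separate
  error bounds let an unchanged argument cost nothing.\<close>

lemma cmod_cinner_blinfun_diff_le:
  fixes S T :: "'a::chilbert_space \<Rightarrow>\<^sub>L 'a"
  assumes "norm x = 1" "norm y = 1" "norm x' = 1" "norm y' = 1"
    and "norm (S - T) \<le> \<eta>" "norm (x - x') \<le> \<mu>" "norm (y - y') \<le> \<nu>" "norm T \<le> B"
  shows "cmod (cinner (S x) y - cinner (T x') y') \<le> \<eta> + B * \<mu> + B * \<nu>"
proof -
  have B: "0 \<le> B" using assms(8) norm_ge_zero order_trans by blast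
  have "cinner (S x) y - cinner (T x') y' = cinner ((S - T) x) y + cinner (T (x - x')) y + cinner (T x') (y - y')"
    by (simp add: blinfun.diff_left blinfun.diff_right cinner.diff_left cinner.diff_right)
  moreover have "cmod (cinner ((S - T) x) y) \<le> \<eta>"
    using cmod_cinner_blinfun_le[of "S - T" x y] assms by simp
  moreover have "cmod (cinner (T (x - x')) y) \<le> B * \<mu>"
    using cmod_cinner_blinfun_le[of T "x - x'" y] mult_mono[OF assms(8) assms(6) B] assms(2) by simp
  moreover have "cmod (cinner (T x') (y - y')) \<le> B * \<nu>"
    using cmod_cinner_blinfun_le[of T x' "y - y'"] mult_mono[OF assms(8) assms(7) B] assms(3) by simp
  ultimately show ?thesis
    using norm_triangle_mono[OF norm_triangle_mono] by metis
qed

section \<open>Almost orthogonal vectors\<close>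

text \<open>Adjoint-free form of: \<open>x\<close> is nearly orthogonal to \<open>y\<close>, to
  \<open>T y\<close> and to the adjoint of \<open>T\<close> applied to \<open>y\<close>. These are
  exactly the cross terms in the norm and in the quadratic form of a combination of \<open>x\<close>
  and \<open>y\<close>.\<close>

definition almost_orth :: "real \<Rightarrow> ('a::chilbert_space \<Rightarrow>\<^sub>L 'a) \<Rightarrow> 'a \<Rightarrow> 'a \<Rightarrow> bool" where
  "almost_orth \<eta> T x y \<longleftrightarrow>
     cmod (cinner x y) \<le> \<eta> \<and> cmod (cinner (T x) y) \<le> \<eta> \<and> cmod (cinner (T y) x) \<le> \<eta>"

text \<open>For a closed subspace \<open>M\<close> this is membership of \<mu> in the essential
  numerical range of the compression of \<open>T\<close> to \<open>M\<close>, with the projection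
  eliminated.\<close>

definition numrange_seq_on :: "'a::chilbert_space set \<Rightarrow> ('a \<Rightarrow>\<^sub>L 'a) \<Rightarrow> complex \<Rightarrow> bool" where
  "numrange_seq_on M T \<mu> \<longleftrightarrow>
     (\<exists>x. (\<forall>n. x n \<in> M) \<and> corthonormal_seq x \<and> (\<lambda>n. cinner (T (x n)) (x n)) \<longlonglongrightarrow> \<mu>)"

text \<open>Carries near orthogonality from a mesh point to a nearby parameter. In the factor
  \<open>2 + B\<close>, one unit is the given bound, one pays for the operator and \<open>B\<close>
  pays for moving \<open>y'\<close> to \<open>y\<close>.\<close>

lemma almost_orth_perturb:
  assumes "almost_orth \<eta> T x y'" "norm x = 1" "norm y = 1" "norm y' = 1"
    and "norm (S - T) \<le> \<eta>" "norm (y - y') \<le> \<eta>" "norm T \<le> B"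
  shows "almost_orth ((2 + B) * \<eta>) S x y"
proof -
  have \<eta>: "0 \<le> \<eta>" using assms(5) norm_ge_zero order_trans by blast
  have B: "0 \<le> B" using assms(7) norm_ge_zero order_trans by blast
  have "cmod (cinner x y - cinner x y') \<le> \<eta>"
    using cmod_cinner_le[of x "y - y'"] assms(2,6) by (simp add: cinner.diff_right)
  moreover have "cmod (cinner (S x) y - cinner (T x) y') \<le> \<eta> + B * \<eta>"
    using cmod_cinner_blinfun_diff_le[where \<mu> = 0, of x y x y' S T \<eta> \<eta> B] assms by simp
  moreover have "cmod (cinner (S y) x - cinner (T y') x) \<le> \<eta> + B * \<eta>"
    using cmod_cinner_blinfun_diff_le[where \<nu> = 0, of y x y' x S T \<eta> \<eta> B] assms by simp
  moreover have "0 \<le> B * \<eta>" using \<eta> B by simp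
  ultimately show ?thesis
    using assms(1) norm_triangle_sub[of "cinner x y" "cinner x y'"]
      norm_triangle_sub[of "cinner (S x) y" "cinner (T x) y'"]
      norm_triangle_sub[of "cinner (S y) x" "cinner (T y') x"]
    unfolding almost_orth_def distrib_right by linarith
qed

lemma almost_orth_combination:
  assumes "almost_orth \<eta> T p y" "almost_orth \<eta> T q y" "\<bar>a\<bar> \<le> 1" "\<bar>b\<bar> \<le> 1"
  shows "almost_orth (2 * \<eta>) T (a *\<^sub>R p + b *\<^sub>R q) y"
proof -
  have *: "cmod (a *\<^sub>R g + b *\<^sub>R h) \<le> 2 * \<eta>" if "cmod g \<le> \<eta>" "cmod h \<le> \<eta>" for g h
  proof -
    have "cmod (a *\<^sub>R g) \<le> 1 * \<eta>" "cmod (b *\<^sub>R h) \<le> 1 * \<eta>"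
      unfolding norm_scaleR using that assms(3,4) by (intro mult_mono; simp)+
    then show ?thesis using norm_triangle_mono[of "a *\<^sub>R g" "1 * \<eta>" "b *\<^sub>R h" "1 * \<eta>"] by simp
  qed
  show ?thesis
    using assms(1,2) unfolding almost_orth_def
    by (simp add: blinfun.add_right blinfun.scaleR_right cinner_add_left cinner_add_right
        cinner.scaleR_left cinner.scaleR_right *)
qed

text \<open>All late members of an orthonormal sequence are nearly orthogonal to any two prescribed
  vectors, so dependent choice can fit each \<open>w (Suc n)\<close> to both
  \<open>y (Suc n)\<close> and its predecessor \<open>w n\<close>.\<close>

lemma almost_orthogonal_sequence:
  fixes T :: "nat \<Rightarrow> 'a::chilbert_space \<Rightarrow>\<^sub>L 'a"
  assumes T: "\<And>n. clinear_map (blinfun_apply (T n))"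
    and seq: "\<And>n. numrange_seq_on M (T n) (\<mu> n)" and \<eta>: "0 < \<eta>"
  shows "\<exists>w. \<forall>n. (w n \<in> M \<and> norm (w n) = 1 \<and> cmod (cinner (T n (w n)) (w n) - \<mu> n) \<le> \<eta>
           \<and> almost_orth \<eta> (T n) (w n) (y n)) \<and> almost_orth \<eta> (T (Suc n)) (w (Suc n)) (w n)"
proof (rule dependent_nat_choice)
  have *: "\<exists>w. (w \<in> M \<and> norm w = 1 \<and> cmod (cinner (T n w) w - \<mu> n) \<le> \<eta>
           \<and> almost_orth \<eta> (T n) w (y n)) \<and> almost_orth \<eta> (T n) w z" for n z
  proof -
    obtain x where x: "\<And>k. x k \<in> M" "corthonormal_seq x" "(\<lambda>k. cinner (T n (x k)) (x k)) \<longlonglongrightarrow> \<mu> n"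
      using seq[of n] unfolding numrange_seq_on_def by blast
    have "\<forall>\<^sub>F k in sequentially. cmod (cinner (T n (x k)) (x k) - \<mu> n) < \<eta>"
      using tendstoD[OF x(3) \<eta>] by (simp add: dist_norm)
    moreover have "\<forall>\<^sub>F k in sequentially. almost_orth \<eta> (T n) (x k) (y n)"
      "\<forall>\<^sub>F k in sequentially. almost_orth \<eta> (T n) (x k) z"
      unfolding almost_orth_def using corthonormal_eventually_small[OF x(2) T \<eta>] by auto
    ultimately have "\<forall>\<^sub>F k in sequentially. cmod (cinner (T n (x k)) (x k) - \<mu> n) < \<eta>
        \<and> almost_orth \<eta> (T n) (x k) (y n) \<and> almost_orth \<eta> (T n) (x k) z"
      by eventually_elim simp
    then obtain k where "cmod (cinner (T n (x k)) (x k) - \<mu> n) < \<eta>"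
        "almost_orth \<eta> (T n) (x k) (y n)" "almost_orth \<eta> (T n) (x k) z"
      using eventually_happens'[OF sequentially_bot] by blast
    then show ?thesis
      using x(1) corthonormal_seq_norm[OF x(2)] less_imp_le by blast
  qed
  show "\<exists>w. w \<in> M \<and> norm w = 1 \<and> cmod (cinner (T 0 w) w - \<mu> 0) \<le> \<eta> \<and> almost_orth \<eta> (T 0) w (y 0)"
    using * by blast
  show "\<exists>w'. (w' \<in> M \<and> norm w' = 1 \<and> cmod (cinner (T (Suc n) w') w' - \<mu> (Suc n)) \<le> \<eta>
      \<and> almost_orth \<eta> (T (Suc n)) w' (y (Suc n))) \<and> almost_orth \<eta> (T (Suc n)) w' w" for w n
    using * by blast
qed

section \<open>Continuous paths of almost orthogonal vectors\<close>

text \<open>The hats \<open>max 0 (1 - \<bar>x - real j\<bar>)\<close> form a partition of unity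
  with at most two nonzero members at each point; square roots make the squared weights sum to 1.
  Writing the interpolation as one global sum makes its continuity immediate.\<close>

lemma sum_hat_functions:
  fixes w :: "nat \<Rightarrow> 'a::real_vector" and x :: real
  assumes x: "0 \<le> x" "x \<le> real N"
  obtains i s where "0 \<le> s" "s \<le> 1" "x = real i + s"
    "(\<Sum>j\<le>Suc N. sqrt (max 0 (1 - \<bar>x - real j\<bar>)) *\<^sub>R w j) = sqrt (1 - s) *\<^sub>R w i + sqrt s *\<^sub>R w (Suc i)"
proof -
  define i where "i = nat \<lfloor>x\<rfloor>"
  define s where "s = x - real i"
  have "real i \<le> x" "x < real i + 1" using x(1) by (simp_all add: i_def)
  then have s: "0 \<le> s" "s < 1" "x = real i + s" by (simp_all add: s_def)
  \<comment> \<open>The sum runs to \<open>Suc N\<close> so that the index \<open>Suc i\<close> is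
    still included when \<open>x = real N\<close>.\<close>
  have "real i \<le> real N" using x(2) s(1,3) by linarith
  then have iN: "i \<le> N" by simp
  have zero: "sqrt (max 0 (1 - \<bar>x - real j\<bar>)) *\<^sub>R w j = 0" if "j \<noteq> i" "j \<noteq> Suc i" for j
  proof -
    have "real j + 1 \<le> real i \<or> real i + 2 \<le> real j" using that by linarith
    then have "1 \<le> \<bar>x - real j\<bar>" using s by auto
    then show ?thesis by simp
  qed
  have "(\<Sum>j\<le>Suc N. sqrt (max 0 (1 - \<bar>x - real j\<bar>)) *\<^sub>R w j)
      = (\<Sum>j\<in>{i, Suc i}. sqrt (max 0 (1 - \<bar>x - real j\<bar>)) *\<^sub>R w j)"
    by (rule sum.mono_neutral_right) (use iN zero in auto)
  also have "\<dots> = sqrt (1 - s) *\<^sub>R w i + sqrt s *\<^sub>R w (Suc i)"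
    using s by simp
  finally show ?thesis using that[of s i] s by simp
qed

lemma uniform_mesh:
  fixes f :: "real \<Rightarrow> 'b::metric_space"
  assumes "continuous_on {0..1} f" "0 < \<eta>"
  obtains N :: nat where "0 < N"
    "\<And>s t. s \<in> {0..1} \<Longrightarrow> t \<in> {0..1} \<Longrightarrow> \<bar>s - t\<bar> \<le> 1 / real N \<Longrightarrow> dist (f s) (f t) \<le> \<eta>"
proof -
  have "uniformly_continuous_on {0..1} f"
    using assms(1) by (intro compact_uniformly_continuous) auto
  then obtain \<delta> where \<delta>: "0 < \<delta>" "\<And>s t. s \<in> {0..1} \<Longrightarrow> t \<in> {0..1} \<Longrightarrow> dist s t < \<delta> \<Longrightarrow> dist (f s) (f t) < \<eta>"
    using assms(2) unfolding uniformly_continuous_on_def by metis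
  obtain n where "inverse (real (Suc n)) < \<delta>" using reals_Archimedean \<delta>(1) by blast
  then show ?thesis
    using that[of "Suc n"] \<delta>(2) by (simp add: dist_real_def inverse_eq_divide less_imp_le)
qed

text \<open>Vectors are chosen at mesh points and interpolated; at each \<open>t\<close> only two
  neighbouring ones enter, and uniform continuity compares the data at \<open>t\<close> with those
  at their mesh points.\<close>

lemma almost_orthogonal_path:
  fixes A :: "real \<Rightarrow> 'a::chilbert_space \<Rightarrow>\<^sub>L 'a"
  assumes A: "continuous_on {0..1} A" "\<And>t. t \<in> {0..1} \<Longrightarrow> clinear_map (blinfun_apply (A t))"
    and v: "continuous_on {0..1} v" "\<And>t. t \<in> {0..1} \<Longrightarrow> norm (v t) = 1"
    and \<mu>: "continuous_on {0..1} \<mu>" "\<And>t. t \<in> {0..1} \<Longrightarrow> numrange_seq_on M (A t) (\<mu> t)"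
    and M: "csubspace M" and \<eta>: "0 < \<eta>"
  shows "\<exists>w. continuous_on {0..1} w \<and> (\<forall>t\<in>{0..1}. w t \<in> M \<and> cmod (cinner (w t) (w t) - 1) \<le> \<eta>
           \<and> cmod (cinner (A t (w t)) (w t) - \<mu> t) \<le> \<eta> \<and> almost_orth \<eta> (A t) (w t) (v t))"
proof -
  have "bounded (A ` {0..1})"
    using A(1) by (intro compact_imp_bounded compact_continuous_image) auto
  then obtain B where B: "0 < B" "\<And>t. t \<in> {0..1} \<Longrightarrow> norm (A t) \<le> B"
    unfolding bounded_pos by auto
  \<comment> \<open>The interpolated quadratic form will be off by at most
    \<open>3 * \<kappa> + 2 * \<kappa>\<close>, whence the 5; \<zeta> then absorbs the factor
    \<open>2 + B\<close> of \<open>almost_orth_perturb\<close>.\<close>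
  define \<kappa> where "\<kappa> = \<eta> / 5"
  define \<zeta> where "\<zeta> = \<kappa> / (2 + B)"
  have \<kappa>: "0 < \<kappa>" using \<eta> by (simp add: \<kappa>_def)
  then have \<zeta>: "0 < \<zeta>" "(2 + B) * \<zeta> = \<kappa>"
    using B(1) by (simp_all add: \<zeta>_def)
  have \<zeta>\<kappa>: "2 * \<zeta> \<le> \<kappa>"
    using \<zeta> B(1) mult_right_mono[of 2 "2 + B" \<zeta>] by simp
  have "continuous_on {0..1} (\<lambda>t. (A t, v t, \<mu> t))"
    by (intro continuous_intros A v \<mu>)
  then obtain N where N: "0 < N" and mesh: "\<And>s t. s \<in> {0..1} \<Longrightarrow> t \<in> {0..1} \<Longrightarrow> \<bar>s - t\<bar> \<le> 1 / real N
      \<Longrightarrow> dist (A s, v s, \<mu> s) (A t, v t, \<mu> t) \<le> \<zeta>"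
    using uniform_mesh[OF _ \<zeta>(1)] by blast
  have near: "norm (A s - A t) \<le> \<zeta>" "norm (v s - v t) \<le> \<zeta>" "cmod (\<mu> s - \<mu> t) \<le> \<zeta>"
    if "s \<in> {0..1}" "t \<in> {0..1}" "\<bar>s - t\<bar> \<le> 1 / real N" for s t
    using mesh[OF that] dist_fst_le[of "(A s, v s, \<mu> s)" "(A t, v t, \<mu> t)"]
      dist_snd_le[of "(A s, v s, \<mu> s)" "(A t, v t, \<mu> t)"]
      dist_fst_le[of "(v s, \<mu> s)" "(v t, \<mu> t)"] dist_snd_le[of "(v s, \<mu> s)" "(v t, \<mu> t)"]
    by (auto simp: dist_norm)
  \<comment> \<open>The sequence of vectors is indexed by all naturals; truncation at 1 keeps every
    mesh point, in particular the one for \<open>Suc N\<close>, inside the interval.\<close>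
  define \<tau> where "\<tau> i = min (real i / real N) 1" for i
  have \<tau>: "\<tau> i \<in> {0..1}" for i by (simp add: \<tau>_def)
  obtain p where p: "\<And>i. p i \<in> M" "\<And>i. norm (p i) = 1"
      "\<And>i. cmod (cinner (A (\<tau> i) (p i)) (p i) - \<mu> (\<tau> i)) \<le> \<zeta>"
      "\<And>i. almost_orth \<zeta> (A (\<tau> i)) (p i) (v (\<tau> i))"
      "\<And>i. almost_orth \<zeta> (A (\<tau> (Suc i))) (p (Suc i)) (p i)"
    using almost_orthogonal_sequence[where T = "\<lambda>i. A (\<tau> i)" and \<mu> = "\<lambda>i. \<mu> (\<tau> i)" and y = "\<lambda>i. v (\<tau> i)",
        OF A(2)[OF \<tau>] \<mu>(2)[OF \<tau>] \<zeta>(1)] by blast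
  define w where "w t = (\<Sum>j\<le>Suc N. sqrt (max 0 (1 - \<bar>real N * t - real j\<bar>)) *\<^sub>R p j)" for t
  have "continuous_on {0..1} w"
    unfolding w_def by (intro continuous_intros)
  moreover have "w t \<in> M \<and> cmod (cinner (w t) (w t) - 1) \<le> \<eta>
           \<and> cmod (cinner (A t (w t)) (w t) - \<mu> t) \<le> \<eta> \<and> almost_orth \<eta> (A t) (w t) (v t)"
    if t: "t \<in> {0..1}" for t
  proof -
    have "0 \<le> real N * t" "real N * t \<le> real N" using t by (auto simp: mult_left_le)
    then obtain i s where s: "0 \<le> s" "s \<le> 1" "real N * t = real i + s"
        "w t = sqrt (1 - s) *\<^sub>R p i + sqrt s *\<^sub>R p (Suc i)"
      using sum_hat_functions[of "real N * t" N p] unfolding w_def by blast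
    have teq: "t = (real i + s) / real N" using s(3) N by (simp add: field_simps)
    have close: "\<bar>t - \<tau> j\<bar> \<le> 1 / real N" if "j = i \<or> j = Suc i" for j
    proof -
      have "\<bar>t - real j / real N\<bar> = \<bar>real i + s - real j\<bar> / real N"
        using N by (simp add: teq diff_divide_distrib[symmetric])
      also have "\<dots> \<le> 1 / real N"
        using that s N by (intro divide_right_mono) auto
      \<comment> \<open>Since \<open>t \<le> 1\<close>, truncation can only bring the mesh point
        closer to \<open>t\<close>.\<close>
      finally show ?thesis using t unfolding \<tau>_def by auto
    qed
    have diag: "cmod (cinner (A t (p j)) (p j) - \<mu> t) \<le> 3 * \<kappa>" and vp: "almost_orth \<kappa> (A t) (p j) (v t)"
      if j: "j = i \<or> j = Suc i" for j
    proof -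
      note n = near[OF t \<tau> close[OF j]]
      have "cmod (cinner (A t (p j)) (p j) - cinner (A (\<tau> j) (p j)) (p j)) \<le> \<zeta>"
        using cmod_cinner_blinfun_diff_le[of "p j" "p j" "p j" "p j" "A t" "A (\<tau> j)" \<zeta> 0 0 B] p(2) n(1) B(2)[OF \<tau>] by simp
      moreover have "cmod (\<mu> (\<tau> j) - \<mu> t) \<le> \<zeta>" using n(3) by (simp add: norm_minus_commute)
      ultimately have "cmod (cinner (A t (p j)) (p j) - \<mu> t) \<le> \<zeta> + (\<zeta> + \<zeta>)"
        using norm_diff_triangle_le[OF _ norm_diff_triangle_le] p(3)[of j] by blast
      then show "cmod (cinner (A t (p j)) (p j) - \<mu> t) \<le> 3 * \<kappa>" using \<zeta>\<kappa> \<kappa> by linarith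
      show "almost_orth \<kappa> (A t) (p j) (v t)"
        using almost_orth_perturb[OF p(4)[of j] p(2) v(2)[OF t] v(2)[OF \<tau>] n(1,2) B(2)[OF \<tau>]] \<zeta>(2) by simp
    qed
    have pp: "almost_orth \<kappa> (A t) (p (Suc i)) (p i)"
      using almost_orth_perturb[OF p(5)[of i] p(2) p(2) p(2) near(1)[OF t \<tau> close] _ B(2)[OF \<tau>]] \<zeta>
      by simp
    have sq: "(sqrt (1 - s))\<^sup>2 + (sqrt s)\<^sup>2 = 1" using s by simp
    have "cmod (cinner (A t (w t)) (w t) - (of_real ((sqrt (1 - s))\<^sup>2) * \<mu> t + of_real ((sqrt s)\<^sup>2) * \<mu> t)) \<le> 3 * \<kappa> + 2 * \<kappa>"
      unfolding s(4) using pp diag unfolding almost_orth_def by (intro cmod_quadratic_form_combination sq) auto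
    then have q: "cmod (cinner (A t (w t)) (w t) - \<mu> t) \<le> \<eta>"
      unfolding distrib_right[symmetric] of_real_add[symmetric] sq by (simp add: \<kappa>_def)
    \<comment> \<open>The squared norm is the quadratic form of the identity; as the
      \<open>p j\<close> are exact unit vectors, only the cross terms contribute.\<close>
    have "cmod (cinner (id_blinfun (w t)) (w t) - (of_real ((sqrt (1 - s))\<^sup>2) * 1 + of_real ((sqrt s)\<^sup>2) * 1)) \<le> 0 + 2 * \<kappa>"
      unfolding s(4) using pp p(2) unfolding almost_orth_def
      by (intro cmod_quadratic_form_combination sq) (auto simp: cinner_self_norm cmod_cinner_commute[of "p i"])
    then have n: "cmod (cinner (w t) (w t) - 1) \<le> \<eta>"
      unfolding distrib_right[symmetric] of_real_add[symmetric] sq using \<eta> by (simp add: \<kappa>_def)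
    have "almost_orth (2 * \<kappa>) (A t) (w t) (v t)"
      unfolding s(4) using vp s(1,2) by (intro almost_orth_combination) auto
    then have "almost_orth \<eta> (A t) (w t) (v t)"
      using \<eta> unfolding almost_orth_def \<kappa>_def by linarith
    moreover have "w t \<in> M"
      unfolding s(4) using M p(1) csubspace_scaleR[OF M] by (simp add: csubspace_def)
    ultimately show ?thesis using q n by blast
  qed
  ultimately show ?thesis by blast
qed

section \<open>One correction of the path\<close>

text \<open>With \<open>n = norm z\<close>, the displacement is \<open>\<bar>n - 1\<bar>\<close>,
  which is at most \<open>\<bar>n\<^sup>2 - 1\<bar>\<close>. Rescaling divides the form by
  \<open>n\<^sup>2\<close>, at least 1/2: this gives the factor 2, and the change of target from
  \<open>n\<^sup>2 * d\<close> to \<open>d\<close> gives the term with \<open>D\<close>.\<close>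

lemma normalize_approximation:
  fixes T :: "'a::chilbert_space \<Rightarrow>\<^sub>L 'a"
  assumes z: "cmod (cinner z z - 1) \<le> \<delta>" and Tz: "cmod (cinner (T z) z - d) \<le> \<delta>"
    and \<delta>: "\<delta> \<le> 1/2" and D: "cmod d \<le> D"
  defines "u \<equiv> (1 / norm z) *\<^sub>R z"
  shows "norm z > 0" "norm u = 1" "norm (u - z) \<le> \<delta>" "cmod (cinner (T u) u - d) \<le> 2 * (1 + D) * \<delta>"
proof -
  define n where "n = norm z"
  have "cinner z z - 1 = of_real (n\<^sup>2 - 1)" by (simp add: cinner_self_norm n_def)
  then have n2: "\<bar>n\<^sup>2 - 1\<bar> \<le> \<delta>" using z by (metis norm_of_real)
  then have half: "1/2 \<le> n\<^sup>2" using \<delta> by linarith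
  then show pos: "norm z > 0" by (auto simp: n_def)
  then have n0: "0 < n" by (simp add: n_def)
  show "norm u = 1" using pos by (simp add: u_def)
  have "u - z = (1 / n - 1) *\<^sub>R z" by (simp add: u_def n_def scaleR_diff_left)
  then have "norm (u - z) = \<bar>1 / n - 1\<bar> * n" by (simp add: n_def)
  also have "\<dots> = \<bar>(1 / n - 1) * n\<bar>" using n0 by (simp add: abs_mult)
  also have "\<dots> = \<bar>n - 1\<bar>" using n0 by (simp add: left_diff_distrib abs_minus_commute)
  also have "\<dots> \<le> \<bar>n - 1\<bar> * (n + 1)" using n0 by (simp add: mult_le_cancel_left1)
  also have "\<dots> = \<bar>(n - 1) * (n + 1)\<bar>" using n0 by (simp add: abs_mult)
  also have "(n - 1) * (n + 1) = n\<^sup>2 - 1" by (simp add: algebra_simps power2_eq_square)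
  finally show "norm (u - z) \<le> \<delta>" using n2 by linarith
  have D0: "0 \<le> D" using D norm_ge_zero order_trans by blast
  have \<delta>0: "0 \<le> \<delta>" using z norm_ge_zero order_trans by blast
  have "cinner (T u) u - d = (1 / n\<^sup>2) *\<^sub>R (cinner (T z) z - d + (1 - n\<^sup>2) *\<^sub>R d)"
    using n0 by (simp add: u_def n_def[symmetric] blinfun.scaleR_right cinner.scaleR_left cinner.scaleR_right
        scaleR_conv_of_real field_simps power2_eq_square)
  then have "cmod (cinner (T u) u - d) = (1 / n\<^sup>2) * cmod (cinner (T z) z - d + (1 - n\<^sup>2) *\<^sub>R d)"
    by simp
  also have "\<dots> \<le> 2 * (\<delta> + \<delta> * D)"
  proof (intro mult_mono norm_triangle_mono Tz)
    show "1 / n\<^sup>2 \<le> 2" using half n0 by (simp add: field_simps)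
    show "cmod ((1 - n\<^sup>2) *\<^sub>R d) \<le> \<delta> * D"
      unfolding norm_scaleR using n2 D \<delta>0 by (intro mult_mono) auto
  qed auto
  also have "\<dots> = 2 * (1 + D) * \<delta>" by (simp add: algebra_simps)
  finally show "cmod (cinner (T u) u - d) \<le> 2 * (1 + D) * \<delta>" .
qed

text \<open>The two equations determine the weights. For the size,
  \<open>1 - a \<le> 1 - a\<^sup>2 = b\<^sup>2 \<le> b\<close>, so the sum is at most
  \<open>2 * b\<close>, and \<open>4 * b\<^sup>2 \<le> 8 * (\<epsilon> / \<theta>)\<close>.\<close>

lemma balancing_weights:
  fixes \<epsilon> \<theta> :: real
  assumes "0 < \<epsilon>" "0 < \<theta>"
  obtains a b where "0 \<le> a" "0 \<le> b" "a\<^sup>2 + b\<^sup>2 = 1" "a\<^sup>2 = b\<^sup>2 * (\<theta> / (2 * \<epsilon>))"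
    "(1 - a) + b \<le> 3 * sqrt (\<epsilon> / \<theta>)" "b \<le> 1"
proof -
  define K where "K = \<theta> / (2 * \<epsilon>)"
  have K: "0 < K" using assms by (simp add: K_def)
  define a b where "a = sqrt (K / (1 + K))" and "b = sqrt (1 / (1 + K))"
  have a2: "a\<^sup>2 = K / (1 + K)" and b2: "b\<^sup>2 = 1 / (1 + K)"
    using K by (simp_all add: a_def b_def)
  have a0: "0 \<le> a" and b0: "0 \<le> b" using K by (simp_all add: a_def b_def)
  have sum1: "a\<^sup>2 + b\<^sup>2 = 1" unfolding a2 b2 using K by (simp add: add_divide_distrib[symmetric])
  have rel: "a\<^sup>2 = b\<^sup>2 * K" unfolding a2 b2 by simp
  have a1: "a \<le> 1" and b1: "b \<le> 1" using K by (simp_all add: a_def b_def)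
  have "a\<^sup>2 \<le> a" "b\<^sup>2 \<le> b" using a0 b0 a1 b1 by (simp_all add: power2_eq_square mult_left_le)
  then have "(1 - a) + b \<le> 2 * b" using sum1 by linarith
  also have "\<dots> \<le> 3 * sqrt (\<epsilon> / \<theta>)"
  proof (rule power2_le_imp_le)
    have "b\<^sup>2 \<le> 1 / K" unfolding b2 using K by (intro divide_left_mono) auto
    also have "\<dots> = 2 * (\<epsilon> / \<theta>)" by (simp add: K_def)
    finally have "4 * b\<^sup>2 \<le> 9 * (\<epsilon> / \<theta>)"
      using divide_pos_pos[OF assms] by linarith
    then show "(2 * b)\<^sup>2 \<le> (3 * sqrt (\<epsilon> / \<theta>))\<^sup>2"
      using assms by (simp add: power_mult_distrib)
    show "0 \<le> 3 * sqrt (\<epsilon> / \<theta>)" using assms by simp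
  qed
  finally show ?thesis using that[of a b] a0 b0 sum1 rel b1 unfolding K_def by blast
qed

text \<open>The remaining error stems only from the defects of \<open>w\<close>, which are at free
  disposal. A quarter is chosen because the step length scales with the square root of the error:
  successive steps then halve and are summable.\<close>

lemma improve_approximation:
  fixes A :: "real \<Rightarrow> 'a::chilbert_space \<Rightarrow>\<^sub>L 'a"
  assumes A: "continuous_on {0..1} A" "\<And>t. t \<in> {0..1} \<Longrightarrow> clinear_map (blinfun_apply (A t))"
    and v: "continuous_on {0..1} v" "\<And>t. t \<in> {0..1} \<Longrightarrow> norm (v t) = 1"
    and d: "continuous_on {0..1} d"
    and range: "\<And>t \<mu>. t \<in> {0..1} \<Longrightarrow> dist (d t) \<mu> < \<theta> \<Longrightarrow> numrange_seq_on M (A t) \<mu>"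
    and M: "csubspace M" and \<epsilon>: "0 < \<epsilon>" and \<theta>: "0 < \<theta>"
    and approx: "\<And>t. t \<in> {0..1} \<Longrightarrow> cmod (cinner (A t (v t)) (v t) - d t) \<le> \<epsilon>"
  shows "\<exists>u. continuous_on {0..1} u \<and> (\<forall>t\<in>{0..1}. norm (u t) = 1
           \<and> cmod (cinner (A t (u t)) (u t) - d t) \<le> \<epsilon> / 4
           \<and> norm (u t - v t) \<le> 4 * sqrt (\<epsilon> / \<theta>) \<and> (\<exists>c. \<exists>m\<in>M. u t = c *\<^sub>R v t + m))"
proof -
  define K where "K = \<theta> / (2 * \<epsilon>)"
  define r where "r = sqrt (\<epsilon> / \<theta>)"
  have r: "0 < r" using \<epsilon> \<theta> by (simp add: r_def)
  obtain a b where ab: "0 \<le> a" "0 \<le> b" "a\<^sup>2 + b\<^sup>2 = 1" "a\<^sup>2 = b\<^sup>2 * K" "(1 - a) + b \<le> 3 * r" "b \<le> 1"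
    using balancing_weights[OF \<epsilon> \<theta>] unfolding K_def r_def by metis
  have "bounded (d ` {0..1})"
    using d by (intro compact_imp_bounded compact_continuous_image) auto
  then obtain D where D: "0 < D" "\<And>t. t \<in> {0..1} \<Longrightarrow> cmod (d t) \<le> D"
    unfolding bounded_pos by auto
  \<comment> \<open>The three bounds serve, in turn, the hypothesis of
    \<open>normalize_approximation\<close>, the displacement budget and the new error
    \<open>\<epsilon> / 4\<close>.\<close>
  define \<eta> where "\<eta> = min (1/6) (min (r / 4) (\<epsilon> / (24 * (1 + D))))"
  have \<eta>: "0 < \<eta>" using r \<epsilon> D(1) by (simp add: \<eta>_def)
  have \<eta>_le: "3 * \<eta> \<le> 1/2" "4 * \<eta> \<le> r" by (simp_all add: \<eta>_def)
  have "\<eta> \<le> \<epsilon> / (24 * (1 + D))" by (simp add: \<eta>_def)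
  then have \<eta>\<epsilon>: "2 * (1 + D) * (3 * \<eta>) \<le> \<epsilon> / 4" using D(1) by (simp add: field_simps)
  \<comment> \<open>The error at \<open>v t\<close> is reflected through \<open>d t\<close> and
    stretched by \<open>K\<close>; its length becomes at most
    \<open>K * \<epsilon> = \<theta> / 2\<close>, so the point stays in the disc covered by
    \<open>range\<close>.\<close>
  define \<mu> where "\<mu> t = d t - K *\<^sub>R (cinner (A t (v t)) (v t) - d t)" for t
  have \<mu>_cont: "continuous_on {0..1} \<mu>"
    unfolding \<mu>_def
    by (intro continuous_intros d cinner.continuous_on v(1)
        bounded_bilinear.continuous_on[OF bounded_bilinear_blinfun_apply] A(1))
  have \<mu>_range: "numrange_seq_on M (A t) (\<mu> t)" if t: "t \<in> {0..1}" for t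
  proof (rule range[OF t])
    have K0: "0 \<le> K" using \<epsilon> \<theta> by (simp add: K_def)
    have "dist (d t) (\<mu> t) = K * cmod (cinner (A t (v t)) (v t) - d t)"
      using K0 by (simp add: \<mu>_def dist_norm)
    also have "\<dots> \<le> K * \<epsilon>" using approx[OF t] K0 by (rule mult_left_mono)
    also have "\<dots> < \<theta>" using \<epsilon> \<theta> by (simp add: K_def)
    finally show "dist (d t) (\<mu> t) < \<theta>" .
  qed
  obtain w where w: "continuous_on {0..1} w" "\<And>t. t \<in> {0..1} \<Longrightarrow> w t \<in> M"
      "\<And>t. t \<in> {0..1} \<Longrightarrow> cmod (cinner (w t) (w t) - 1) \<le> \<eta>"
      "\<And>t. t \<in> {0..1} \<Longrightarrow> cmod (cinner (A t (w t)) (w t) - \<mu> t) \<le> \<eta>"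
      "\<And>t. t \<in> {0..1} \<Longrightarrow> almost_orth \<eta> (A t) (w t) (v t)"
    using almost_orthogonal_path[OF A v \<mu>_cont \<mu>_range M \<eta>] by blast
  define z where "z t = a *\<^sub>R v t + b *\<^sub>R w t" for t
  define u where "u t = (1 / norm (z t)) *\<^sub>R z t" for t
  have z1: "cmod (cinner (z t) (z t) - 1) \<le> 3 * \<eta>" if t: "t \<in> {0..1}" for t
  proof -
    have "cmod (cinner (id_blinfun (z t)) (z t) - (of_real (a\<^sup>2) * 1 + of_real (b\<^sup>2) * 1)) \<le> \<eta> + 2 * \<eta>"
      unfolding z_def using w(3,5)[OF t] v(2)[OF t] \<eta> unfolding almost_orth_def
      by (intro cmod_quadratic_form_combination ab(3)) (auto simp: cinner_self_norm cmod_cinner_commute[of "v t"])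
    then show ?thesis
      unfolding distrib_right[symmetric] of_real_add[symmetric] ab(3) by simp
  qed
  have z2: "cmod (cinner (A t (z t)) (z t) - d t) \<le> 3 * \<eta>" if t: "t \<in> {0..1}" for t
  proof -
    have "cmod (cinner (A t (z t)) (z t) - (of_real (a\<^sup>2) * cinner (A t (v t)) (v t) + of_real (b\<^sup>2) * \<mu> t)) \<le> \<eta> + 2 * \<eta>"
      unfolding z_def using w(4,5)[OF t] \<eta> unfolding almost_orth_def
      by (intro cmod_quadratic_form_combination ab(3)) auto
    \<comment> \<open>Since \<open>a\<^sup>2 = b\<^sup>2 * K\<close>, the error at
      \<open>v t\<close> and its stretched reflection cancel exactly.\<close>
    moreover have "of_real (a\<^sup>2) * cinner (A t (v t)) (v t) + of_real (b\<^sup>2) * \<mu> t = of_real (a\<^sup>2 + b\<^sup>2) * d t"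
      unfolding ab(4) \<mu>_def by (simp add: scaleR_conv_of_real algebra_simps)
    ultimately show ?thesis by (simp add: ab(3))
  qed
  note norm_u = normalize_approximation[OF z1 z2 \<eta>_le(1) D(2), folded u_def]
  have "continuous_on {0..1} z"
    unfolding z_def by (intro continuous_intros v w)
  then have "continuous_on {0..1} u"
    unfolding u_def using norm_u(1) by (intro continuous_intros) auto
  moreover have "norm (u t) = 1 \<and> cmod (cinner (A t (u t)) (u t) - d t) \<le> \<epsilon> / 4
           \<and> norm (u t - v t) \<le> 4 * r \<and> (\<exists>c. \<exists>m\<in>M. u t = c *\<^sub>R v t + m)"
    if t: "t \<in> {0..1}" for t
  proof (intro conjI)
    show "norm (u t) = 1" using norm_u(2) t by blast
    show "cmod (cinner (A t (u t)) (u t) - d t) \<le> \<epsilon> / 4"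
      using norm_u(4)[OF t t t] \<eta>\<epsilon> by linarith
    \<comment> \<open>\<open>w t\<close> is only nearly a unit vector; its norm is at most
      \<open>1 + \<eta>\<close>.\<close>
    have "cinner (w t) (w t) - 1 = of_real ((norm (w t))\<^sup>2 - 1)" by (simp add: cinner_self_norm)
    then have "\<bar>(norm (w t))\<^sup>2 - 1\<bar> \<le> \<eta>" using w(3)[OF t] by (metis norm_of_real)
    moreover have "(1 + \<eta>)\<^sup>2 = 1 + 2 * \<eta> + \<eta>\<^sup>2" by (simp add: power2_sum)
    ultimately have "(norm (w t))\<^sup>2 \<le> (1 + \<eta>)\<^sup>2" using \<eta> zero_le_power2[of \<eta>] by linarith
    then have "norm (w t) \<le> 1 + \<eta>" using \<eta> by (intro power2_le_imp_le[of "norm (w t)"]) auto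
    then have "b * norm (w t) \<le> b * (1 + \<eta>)" using ab(2) by (rule mult_left_mono)
    moreover have "b * \<eta> \<le> \<eta>" using ab(2,6) \<eta> by (intro mult_left_le_one_le) auto
    ultimately have "b * norm (w t) \<le> b + \<eta>" unfolding distrib_left by linarith
    moreover have "a\<^sup>2 \<le> 1\<^sup>2" using ab(3) zero_le_power2[of b] unfolding one_power2 by linarith
    then have "a \<le> 1" by (rule power2_le_imp_le) simp
    ultimately have "norm ((a - 1) *\<^sub>R v t) \<le> 1 - a" "norm (b *\<^sub>R w t) \<le> b + \<eta>"
      using ab(2) v(2)[OF t] by simp_all
    then have "norm ((a - 1) *\<^sub>R v t + b *\<^sub>R w t) \<le> (1 - a) + (b + \<eta>)"
      by (rule norm_triangle_mono)
    moreover have "(a - 1) *\<^sub>R v t + b *\<^sub>R w t = z t - v t"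
      by (simp add: z_def scaleR_diff_left)
    ultimately have "norm (z t - v t) \<le> (1 - a) + (b + \<eta>)" by simp
    \<comment> \<open>Budget: \<open>3 * \<eta>\<close> for normalising, \<open>3 * r\<close> for
      the weights, \<eta> for the norm of \<open>w t\<close>; \<open>4 * \<eta> \<le> r\<close>
      brings the total to \<open>4 * r\<close>.\<close>
    then have "norm (u t - v t) \<le> 3 * \<eta> + ((1 - a) + (b + \<eta>))"
      by (rule norm_diff_triangle_le[OF norm_u(3)[OF t t t]])
    then show "norm (u t - v t) \<le> 4 * r" using ab(5) \<eta>_le(2) by linarith
    have "u t = (a / norm (z t)) *\<^sub>R v t + (b / norm (z t)) *\<^sub>R w t"
      by (simp add: u_def z_def scaleR_add_right)
    then show "\<exists>c. \<exists>m\<in>M. u t = c *\<^sub>R v t + m"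
      using csubspace_scaleR[OF M w(2)[OF t]] by blast
  qed
  ultimately show ?thesis unfolding r_def by blast
qed

section \<open>Iteration to the exact value\<close>

text \<open>The correction is repeated with errors \<open>\<epsilon> / 4 ^ n\<close>. The same
  \<theta> serves at every stage because \<open>range\<close> concerns only \<open>d\<close> and
  \<open>A\<close>, not the current path.\<close>

lemma exact_value_path:
  fixes A :: "real \<Rightarrow> 'a::chilbert_space \<Rightarrow>\<^sub>L 'a"
  assumes A: "continuous_on {0..1} A" "\<And>t. t \<in> {0..1} \<Longrightarrow> clinear_map (blinfun_apply (A t))"
    and v: "continuous_on {0..1} v" "\<And>t. t \<in> {0..1} \<Longrightarrow> norm (v t) = 1"
    and d: "continuous_on {0..1} d"
    and range: "\<And>t \<mu>. t \<in> {0..1} \<Longrightarrow> dist (d t) \<mu> < \<theta> \<Longrightarrow> numrange_seq_on M (A t) \<mu>"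
    and M: "csubspace M" and \<epsilon>: "0 < \<epsilon>" and \<theta>: "0 < \<theta>"
    and approx: "\<And>t. t \<in> {0..1} \<Longrightarrow> cmod (cinner (A t (v t)) (v t) - d t) \<le> \<epsilon>"
  shows "\<exists>u. continuous_on {0..1} u \<and> (\<forall>t\<in>{0..1}. norm (u t) = 1 \<and> cinner (A t (u t)) (u t) = d t
           \<and> norm (u t - v t) \<le> 8 * sqrt (\<epsilon> / \<theta>)
           \<and> u t \<in> closure {c *\<^sub>R v t + m |c m. m \<in> M})"
proof -
  \<comment> \<open>The clause for \<open>n = 0\<close> pins the chosen sequence to start at
    \<open>v\<close>.\<close>
  define P where "P n f \<longleftrightarrow> (n = 0 \<longrightarrow> f = v) \<and> continuous_on {0..1} f \<and> (\<forall>t\<in>{0..1}. norm (f t) = 1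
      \<and> cmod (cinner (A t (f t)) (f t) - d t) \<le> \<epsilon> / 4 ^ n \<and> (\<exists>c. \<exists>m\<in>M. f t = c *\<^sub>R v t + m))"
    for n :: nat and f
  define Q where "Q n f g \<longleftrightarrow> (\<forall>t\<in>{0..1}. norm (g t - f t) \<le> 4 * sqrt (\<epsilon> / \<theta>) * (1/2) ^ n)"
    for n :: nat and f g :: "real \<Rightarrow> 'a"
  have "\<exists>f. \<forall>n. P n (f n) \<and> Q n (f n) (f (Suc n))"
  proof (rule dependent_nat_choice)
    have "0 \<in> M" using M by (simp add: csubspace_def)
    then have "\<exists>c. \<exists>m\<in>M. v t = c *\<^sub>R v t + m" for t
      by (intro exI[of _ 1] bexI[of _ 0]) simp_all
    then have "P 0 v" unfolding P_def using v approx by simp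
    then show "\<exists>f. P 0 f" by blast
  next
    fix f n assume f: "P n f"
    have f_path: "continuous_on {0..1} f" "\<And>t. t \<in> {0..1} \<Longrightarrow> norm (f t) = 1"
      and f_approx: "\<And>t. t \<in> {0..1} \<Longrightarrow> cmod (cinner (A t (f t)) (f t) - d t) \<le> \<epsilon> / 4 ^ n"
      using f by (simp_all add: P_def)
    have "0 < \<epsilon> / 4 ^ n" using \<epsilon> by simp
    then obtain g where g: "continuous_on {0..1} g" "\<And>t. t \<in> {0..1} \<Longrightarrow> norm (g t) = 1"
        "\<And>t. t \<in> {0..1} \<Longrightarrow> cmod (cinner (A t (g t)) (g t) - d t) \<le> \<epsilon> / 4 ^ n / 4"
        "\<And>t. t \<in> {0..1} \<Longrightarrow> norm (g t - f t) \<le> 4 * sqrt (\<epsilon> / 4 ^ n / \<theta>)"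
        "\<And>t. t \<in> {0..1} \<Longrightarrow> \<exists>c. \<exists>m\<in>M. g t = c *\<^sub>R f t + m"
      using improve_approximation[OF A f_path d range M _ \<theta> f_approx] by blast
    \<comment> \<open>A quarter of the error means half of the step length.\<close>
    have "((1/2::real) ^ n)\<^sup>2 = 1 / 4 ^ n"
      by (simp add: power2_eq_square power_mult_distrib[symmetric] power_one_over)
    then have "sqrt (\<epsilon> / 4 ^ n / \<theta>) = sqrt (\<epsilon> / \<theta> * ((1/2) ^ n)\<^sup>2)"
      by simp
    also have "\<dots> = sqrt (\<epsilon> / \<theta>) * (1/2) ^ n" by (subst real_sqrt_mult) simp
    finally have step: "sqrt (\<epsilon> / 4 ^ n / \<theta>) = sqrt (\<epsilon> / \<theta>) * (1/2) ^ n" .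
    have "Q n f g" unfolding Q_def mult.assoc using g(4)[unfolded step] by blast
    moreover have "\<exists>c. \<exists>m\<in>M. g t = c *\<^sub>R v t + m" if t: "t \<in> {0..1}" for t
    proof -
      obtain c m c' m' where "m \<in> M" "f t = c *\<^sub>R v t + m" "m' \<in> M" "g t = c' *\<^sub>R f t + m'"
        using f g(5)[OF t] t unfolding P_def by blast
      then have "g t = (c' * c) *\<^sub>R v t + (c' *\<^sub>R m + m')" "c' *\<^sub>R m + m' \<in> M"
        using M csubspace_scaleR[OF M] by (simp_all add: scaleR_add_right csubspace_def)
      then show ?thesis by blast
    qed
    then have "P (Suc n) g" unfolding P_def using g by (simp add: mult.commute)
    ultimately show "\<exists>g. P (Suc n) g \<and> Q n f g" by blast
  qed
  then obtain f where P: "\<And>n. P n (f n)" and Q: "\<And>n. Q n (f n) (f (Suc n))" by blast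
  have f0: "f 0 = v" using P[of 0] by (simp add: P_def)
  have f_cont: "continuous_on {0..1} (f n)" for n using P[of n] by (simp add: P_def)
  have f_unit: "norm (f n t) = 1"
    and f_err: "cmod (cinner (A t (f n t)) (f n t) - d t) \<le> \<epsilon> / 4 ^ n"
    and f_span: "f n t \<in> {c *\<^sub>R v t + m |c m. m \<in> M}"
    and f_step: "norm (f (Suc n) t - f n t) \<le> 4 * sqrt (\<epsilon> / \<theta>) * (1/2) ^ n"
    if "t \<in> {0..1}" for n t
    using P[of n] Q[of n] that unfolding P_def Q_def by blast+
  define B where "B n = 4 * sqrt (\<epsilon> / \<theta>) * (1/2) ^ n" for n :: nat
  \<comment> \<open>The geometric series doubles the first step: 4 becomes 8.\<close>
  have B: "B sums (8 * sqrt (\<epsilon> / \<theta>))"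
    using sums_mult[OF geometric_sums[of "1/2::real"], of "4 * sqrt (\<epsilon> / \<theta>)"] by (simp add: B_def[abs_def])
  \<comment> \<open>The limit is written as a telescoping series so that the Weierstrass M-test with
    majorant \<open>B\<close> yields uniform convergence, hence continuity.\<close>
  define u where "u t = v t + (\<Sum>n. f (Suc n) t - f n t)" for t
  have "uniform_limit {0..1} (\<lambda>n t. \<Sum>i<n. f (Suc i) t - f i t) (\<lambda>t. \<Sum>i. f (Suc i) t - f i t) sequentially"
    using f_step sums_summable[OF B] unfolding B_def by (intro Weierstrass_m_test) auto
  then have "uniform_limit {0..1} (\<lambda>n t. v t + (\<Sum>i<n. f (Suc i) t - f i t)) u sequentially"
    unfolding u_def by (intro uniform_limit_intros)
  moreover have "v t + (\<Sum>i<n. f (Suc i) t - f i t) = f n t" for n t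
    by (simp add: sum_lessThan_telescope[of "\<lambda>i. f i t"] f0)
  ultimately have lim: "uniform_limit {0..1} f u sequentially" by simp
  have "continuous_on {0..1} u"
    by (rule uniform_limit_theorem[OF _ lim]) (use f_cont in auto)
  moreover have "norm (u t) = 1 \<and> cinner (A t (u t)) (u t) = d t
           \<and> norm (u t - v t) \<le> 8 * sqrt (\<epsilon> / \<theta>) \<and> u t \<in> closure {c *\<^sub>R v t + m |c m. m \<in> M}"
    if t: "t \<in> {0..1}" for t
  proof (intro conjI)
    have ft: "(\<lambda>n. f n t) \<longlonglongrightarrow> u t" using tendsto_uniform_limitI[OF lim t] .
    show "norm (u t) = 1"
      using tendsto_norm[OF ft] f_unit[OF t] by (simp add: LIMSEQ_const_iff)
    have "(\<lambda>n. cinner (A t (f n t)) (f n t)) \<longlonglongrightarrow> cinner (A t (u t)) (u t)"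
      by (intro cinner.tendsto blinfun.tendsto tendsto_const ft)
    moreover have "(\<lambda>n. cinner (A t (f n t)) (f n t) - d t) \<longlonglongrightarrow> 0"
    proof (rule Lim_null_comparison)
      show "\<forall>\<^sub>F n in sequentially. cmod (cinner (A t (f n t)) (f n t) - d t) \<le> \<epsilon> * (1/4) ^ n"
        using f_err[OF t] by (simp add: power_divide)
      show "(\<lambda>n. \<epsilon> * (1/4) ^ n) \<longlonglongrightarrow> 0"
        by (intro tendsto_mult_right_zero LIMSEQ_realpow_zero) auto
    qed
    then have "(\<lambda>n. cinner (A t (f n t)) (f n t)) \<longlonglongrightarrow> d t"
      by (simp add: LIM_zero_iff)
    ultimately show "cinner (A t (u t)) (u t) = d t" using LIMSEQ_unique by blast
    have "norm (\<Sum>n. f (Suc n) t - f n t) \<le> (\<Sum>n. B n)"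
      using f_step[OF t] sums_summable[OF B] by (intro norm_suminf_le) (auto simp: B_def)
    then show "norm (u t - v t) \<le> 8 * sqrt (\<epsilon> / \<theta>)"
      using sums_unique[OF B] by (simp add: u_def)
    show "u t \<in> closure {c *\<^sub>R v t + m |c m. m \<in> M}"
      unfolding closure_sequential by (intro exI[of _ "\<lambda>n. f n t"] conjI allI ft f_span t)
  qed
  ultimately show ?thesis by blast
qed

section \<open>Span, discs inside the essential numerical range, and conclusion\<close>

text \<open>A combination in \<open>cspan\<close> sums over a set, so for \<open>m = x\<close> the
  two terms collapse into one and their coefficients must be added.\<close>

lemma scaleR_plus_in_cspan: "m \<in> M \<Longrightarrow> c *\<^sub>R x + m \<in> cspan ({x} \<union> M)"
proof -
  assume m: "m \<in> M"
  show "c *\<^sub>R x + m \<in> cspan ({x} \<union> M)"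
  proof (cases "m = x")
    case True
    then have "c *\<^sub>R x + m = (\<Sum>y\<in>{x}. scaleC (of_real c + 1) y)"
      by (simp add: scaleR_scaleC scaleC_add_left scaleC_one)
    then show ?thesis unfolding cspan_def
      by (intro CollectI exI[of _ "{x}"] exI[of _ "\<lambda>_. of_real c + 1"]) simp
  next
    case False
    then have "c *\<^sub>R x + m = (\<Sum>y\<in>{x, m}. scaleC (if y = m then 1 else of_real c) y)"
      by (simp add: scaleR_scaleC scaleC_one)
    then show ?thesis unfolding cspan_def
      using m by (intro CollectI exI[of _ "{x, m}"] exI[of _ "\<lambda>y. if y = m then 1 else of_real c"]) simp
  qed
qed

text \<open>A ball is connected: if it met \<open>S\<close> without lying in it, it would contain a
  frontier point at distance less than \<theta>.\<close>

lemma ball_subset_of_interior: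
  fixes S :: "'b::real_normed_vector set"
  assumes "x \<in> interior S" "\<theta> \<le> infdist x (frontier S)"
  shows "ball x \<theta> \<subseteq> S"
proof (rule ccontr)
  assume n: "\<not> ball x \<theta> \<subseteq> S"
  then have "0 < \<theta>" using ball_empty[of \<theta> x] by (cases "\<theta> \<le> 0") auto
  then have "x \<in> ball x \<theta> \<inter> S" using assms(1) interior_subset[of S] by auto
  then have "ball x \<theta> \<inter> S \<noteq> {}" by blast
  then have "ball x \<theta> \<inter> frontier S \<noteq> {}"
    using n by (intro connected_Int_frontier) auto
  then obtain y where "dist x y < \<theta>" "y \<in> frontier S" by auto
  then show False using infdist_le[of y "frontier S" x] assms(2) by linarith
qed

theorem theorem6p3:
  fixes A :: "real \<Rightarrow> ('a::chilbert_space \<Rightarrow>\<^sub>L 'a)"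
    and d :: "real \<Rightarrow> complex"
    and v :: "real \<Rightarrow> 'a"
    and M :: "'a set"
    and \<epsilon> \<theta> :: real
  assumes sep: "csep_space TYPE('a)"
    and infdim: "\<not> cfinite_dim (UNIV :: 'a set)"
    and A_cont: "continuous_on {0..1} A"
    and A_clin: "\<forall>t\<in>{0..1}. clinear_map (blinfun_apply (A t))"
    and d_cont: "continuous_on {0..1} d"
    and d_int: "\<forall>t\<in>{0..1}. d t \<in> interior (ess_numrange (blinfun_apply (A t)))"
    and theta_def: "\<theta> = Inf ((\<lambda>t. infdist (d t) (frontier (ess_numrange (blinfun_apply (A t))))) ` {0..1})"
    and eps: "0 < \<epsilon>" "\<epsilon> < \<theta>"
    and v_cont: "continuous_on {0..1} v"
    and v_unit: "\<forall>t\<in>{0..1}. norm (v t) = 1"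
    and v_approx: "\<forall>t\<in>{0..1}. cmod (cinner (A t (v t)) (v t) - d t) \<le> \<epsilon>"
    and M_sub: "csubspace M" and M_closed: "closed M" and M_infdim: "\<not> cfinite_dim M"
    and M_We: "\<forall>t\<in>{0..1}. ess_numrange_on M (\<lambda>x. cproj M (A t x)) = ess_numrange (blinfun_apply (A t))"
  shows "\<exists>u :: real \<Rightarrow> 'a. continuous_on {0..1} u \<and>
    (\<forall>t\<in>{0..1}. cinner (A t (u t)) (u t) = d t \<and> norm (u t) = 1 \<and>
       norm (u t - v t) \<le> 12 * sqrt (\<epsilon> / \<theta>) \<and>
       u t \<in> closure (cspan ({v t} \<union> M)))"
proof -
  have \<theta>: "0 < \<theta>" using eps by linarith
  \<comment> \<open>The infimum \<theta> bounds the distance to the frontier at every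
    \<open>t\<close>, so the disc about \<open>d t\<close> lies in the essential numerical range of
    \<open>A t\<close>, which \<open>M_We\<close> identifies with that of the compression.\<close>
  have range: "numrange_seq_on M (A t) \<mu>" if t: "t \<in> {0..1}" and \<mu>: "dist (d t) \<mu> < \<theta>" for t \<mu>
  proof -
    have "\<theta> \<le> infdist (d t) (frontier (ess_numrange (blinfun_apply (A t))))"
      unfolding theta_def using t infdist_nonneg by (intro cInf_lower) (auto intro!: bdd_belowI[of _ 0])
    then have "ball (d t) \<theta> \<subseteq> ess_numrange (blinfun_apply (A t))"
      using d_int t by (intro ball_subset_of_interior) auto
    then have "\<mu> \<in> ess_numrange_on M (\<lambda>x. cproj M (A t x))"
      using \<mu> M_We t by auto
    then show ?thesis
      unfolding ess_numrange_on_def numrange_seq_on_def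
      using cinner_cproj[OF M_sub M_closed] by auto
  qed
  obtain u where u: "continuous_on {0..1} u"
      "\<And>t. t \<in> {0..1} \<Longrightarrow> norm (u t) = 1 \<and> cinner (A t (u t)) (u t) = d t
           \<and> norm (u t - v t) \<le> 8 * sqrt (\<epsilon> / \<theta>) \<and> u t \<in> closure {c *\<^sub>R v t + m |c m. m \<in> M}"
    using exact_value_path[OF A_cont A_clin[rule_format] v_cont v_unit[rule_format] d_cont range M_sub
        eps(1) \<theta> v_approx[rule_format]] by blast
  have "closure {c *\<^sub>R v t + m |c m. m \<in> M} \<subseteq> closure (cspan ({v t} \<union> M))" for t
    by (intro closure_mono) (use scaleR_plus_in_cspan in blast)
  moreover have "8 * sqrt (\<epsilon> / \<theta>) \<le> 12 * sqrt (\<epsilon> / \<theta>)" using eps \<theta> by simp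
  ultimately have "cinner (A t (u t)) (u t) = d t \<and> norm (u t) = 1
      \<and> norm (u t - v t) \<le> 12 * sqrt (\<epsilon> / \<theta>) \<and> u t \<in> closure (cspan ({v t} \<union> M))"
    if "t \<in> {0..1}" for t
    using u(2)[OF that] by (meson order_trans subsetD)
  then show ?thesis using u(1) by blast
qed

end
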